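(* The lattice $L_m(\mathbb{C}^2)$, whose elements are the six (distinct) operators $0,\,O_0,\,O_1,\,P_0,\,P_1,\,I_2$ on $\mathbb{C}^2$ with the partial order $O_0\le P_0$, $O_1\le P_1$, least element $0$ and greatest element $I_2$, is non-distributive.
   Context: $P_0,P_1$ are the two one-dimensional projectors onto the coordinate axes of $\mathbb{C}^2$. $O_i=\lambda_iP_i$ with $\lambda_0,\lambda_1\in\mathbb{C}\setminus\{0\}$, $|\lambda_0|^2+|\lambda_1|^2=1$. $I_2$ is the identity operator and $0$ the null operator on $\mathbb{C}^2$. The partial order is not the usual operator order. It comes from comparing, for each fixed index $i$, the range-measures $\mu(\mathrm{ran}(O_i))=\langle\Psi_i|O_i^\dagger O_i|\Psi_i\rangle=|\lambda_i|^2$ and $\mu(\mathrm{ran}(P_i))=\langle\Psi_i|P_i|\Psi_i\rangle=1$, where $\Psi_i$ is the $i$-th standard basis vector. This gives $O_i\le P_i$ for $i=0,1$. The only order relations are these two, those making $0$ the minimum and $I_2$ the maximum, and reflexivity; in particular elements with different indices are incomparable. Meet and join are the infimum and supremum for this order (e.g. $O_i\wedge P_i=O_i$, $O_i\vee P_i=P_i$, $O_0\vee O_1=I_2$, $P_0\wedge O_1=0$). *)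

theory Defs
  imports "HOL-Analysis.Analysis" "HOL-Algebra.Lattice"
begin

text \<open>
  Operators on \<open>\<complex>\<^sup>2\<close> are represented by their matrices in the standard basis, of type
  \<open>complex^2^2\<close>.  The index type \<open>2\<close> has exactly the elements \<open>0\<close> and \<open>1\<close>.
\<close>

type_synonym operator = "complex^2^2"

abbreviation std_basis :: "2 \<Rightarrow> complex^2"
  where "std_basis i \<equiv> axis i 1"

text \<open>Conjugate-linear in the first argument, as in Dirac notation.\<close>

definition cinner :: "complex^2 \<Rightarrow> complex^2 \<Rightarrow> complex"
  where "cinner u v = (\<Sum>k\<in>UNIV. cnj (u $ k) * v $ k)"

definition hermitian_adjoint :: "operator \<Rightarrow> operator"
  where "hermitian_adjoint A = map_matrix cnj (transpose A)"

definition proj_op :: "2 \<Rightarrow> operator"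
  where "proj_op i = matrix (\<lambda>v. axis i (v $ i))"

definition scaled_proj_op :: "(2 \<Rightarrow> complex) \<Rightarrow> 2 \<Rightarrow> operator"
  where "scaled_proj_op lam i = mat (lam i) ** proj_op i"

text \<open>
  The value is a nonnegative real number; for \<open>A = proj_op i\<close>, where
  \<open>hermitian_adjoint A ** A = A\<close>, it is the expectation of \<open>A\<close> itself.
\<close>

definition range_measure :: "2 \<Rightarrow> operator \<Rightarrow> real"
  where "range_measure i A = Re (cinner (std_basis i) ((hermitian_adjoint A ** A) *v std_basis i))"

definition op_le :: "(2 \<Rightarrow> complex) \<Rightarrow> operator \<Rightarrow> operator \<Rightarrow> bool"
  where "op_le lam A B \<longleftrightarrow>
    A = B \<or> A = 0 \<or> B = mat 1 \<or>
    (\<exists>i. A \<in> {scaled_proj_op lam i, proj_op i} \<and> B \<in> {scaled_proj_op lam i, proj_op i} \<and>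
         range_measure i A \<le> range_measure i B)"

definition Lm :: "(2 \<Rightarrow> complex) \<Rightarrow> operator gorder"
  where "Lm lam =
    \<lparr>carrier = {0, scaled_proj_op lam 0, scaled_proj_op lam 1, proj_op 0, proj_op 1, mat 1},
     eq = (=),
     le = op_le lam\<rparr>"

definition distributive :: "('a, 'b) gorder_scheme \<Rightarrow> bool"
  where "distributive L \<longleftrightarrow>
    (\<forall>x\<in>carrier L. \<forall>y\<in>carrier L. \<forall>z\<in>carrier L.
       x \<sqinter>\<^bsub>L\<^esub> (y \<squnion>\<^bsub>L\<^esub> z) = (x \<sqinter>\<^bsub>L\<^esub> y) \<squnion>\<^bsub>L\<^esub> (x \<sqinter>\<^bsub>L\<^esub> z))"

lemma proj_op_nth: "proj_op i $ a $ b = (if a = i \<and> b = i then 1 else 0)"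
  by (simp add: proj_op_def matrix_def axis_def)

lemma scaled_proj_op_nth: "scaled_proj_op lam i $ a $ b = (if a = i \<and> b = i then lam i else 0)"
proof -
  have "(if a = k then lam i else 0) * (if k = i \<and> b = i then 1 else 0)
      = (if k = i then if a = i \<and> b = i then lam i else 0 else 0)" for k
    by simp
  then show ?thesis
    by (simp add: scaled_proj_op_def matrix_matrix_mult_def mat_def proj_op_nth sum.delta)
qed

lemma range_measure_eq: "range_measure i A = (\<Sum>k\<in>UNIV. (cmod (A $ k $ i))\<^sup>2)"
proof -
  have cnj_if: "cnj (if P then 1 else 0) * z = (if P then z else 0)"
    and if_mult: "z * (if P then 1 else 0) = (if P then z else 0)" for P and z :: complex
    by simp_all
  have "cinner (std_basis i) ((hermitian_adjoint A ** A) *v std_basis i)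
      = (\<Sum>k\<in>UNIV. cnj (A $ k $ i) * A $ k $ i)"
    by (simp only: cinner_def axis_def matrix_vector_mult_def matrix_matrix_mult_def
        hermitian_adjoint_def transpose_def nth_map_matrix vec_lambda_beta cnj_if if_mult
        sum.delta finite UNIV_I if_True)
  then show ?thesis
    by (simp add: range_measure_def cmod_power2) (simp add: power2_eq_square)
qed

lemma range_measure_proj_op: "range_measure i (proj_op i) = 1"
proof -
  have "(cmod (proj_op i $ k $ i))\<^sup>2 = (if k = i then 1 else 0)" for k
    by (simp add: proj_op_nth)
  then show ?thesis
    by (simp add: range_measure_eq)
qed

lemma range_measure_scaled_proj_op:
  "range_measure i (scaled_proj_op lam i) = (cmod (lam i))\<^sup>2"
proof -
  have "(cmod (scaled_proj_op lam i $ k $ i))\<^sup>2 = (if k = i then (cmod (lam i))\<^sup>2 else 0)" for k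
    by (simp add: scaled_proj_op_nth)
  then show ?thesis
    by (simp add: range_measure_eq)
qed

lemma op_le_iff:
  assumes "lam 0 \<noteq> 0" and "lam 1 \<noteq> 0" and "(cmod (lam 0))\<^sup>2 + (cmod (lam 1))\<^sup>2 = 1"
  shows "op_le lam A B \<longleftrightarrow>
    A = B \<or> A = 0 \<or> B = mat 1 \<or>
    (A = scaled_proj_op lam 0 \<and> B = proj_op 0) \<or>
    (A = scaled_proj_op lam 1 \<and> B = proj_op 1)"
proof -
  have pos: "0 < (cmod (lam 0))\<^sup>2" "0 < (cmod (lam 1))\<^sup>2"
    using assms by simp_all
  have lt: "(cmod (lam 0))\<^sup>2 < 1" "(cmod (lam 1))\<^sup>2 < 1"
    using pos assms(3) by linarith+
  have ex2: "(\<exists>i::2. Q i) \<longleftrightarrow> Q 0 \<or> Q 1" for Q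
  proof -
    have "i = 0 \<or> i = 1" for i :: 2
      using exhaust_2[of i] by auto
    then show ?thesis by metis
  qed
  show ?thesis
    unfolding op_le_def ex2
    using lt by (auto simp: range_measure_proj_op range_measure_scaled_proj_op)
qed

end

(* O_0 < P_0, and both are complements of O_1 (meet 0, join I_2), so 0, O_0, P_0, O_1, I_2
   form a pentagon; in a distributive lattice an element has at most one complement. *)
theory Submission
  imports Defs
begin

text \<open>Away from \<open>0\<close> and \<open>mat 1\<close> the order consists of two chains,
  O_0 < P_0 and O_1 < P_1, with no relation between them. Elements of different chains therefore
  meet in 0 and join to the identity, so all meets and joins exist. Since O_1 has the same meet and
  the same join with O_0 as with P_0, distributivity would force O_0 = P_0
  (\<open>not_distributive_if_pentagon\<close>). The operators enter only through
  \<open>Lm_distinct\<close> and \<open>op_le_iff\<close>; the rest is order theory in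
  \<open>two_chains_order\<close>.\<close>

lemma (in Lattice.lattice) join_eqI:
  assumes "x \<in> carrier L" "y \<in> carrier L" "least L s (Upper L {x, y})"
  shows "x \<squnion> y = s"
  using assms joinI[of x y "\<lambda>l. l = s"] least_unique by blast

lemma (in Lattice.lattice) meet_eqI:
  assumes "x \<in> carrier L" "y \<in> carrier L" "greatest L i (Lower L {x, y})"
  shows "x \<sqinter> y = i"
  using assms meetI[of x y "\<lambda>l. l = i"] greatest_unique by blast

text \<open>By absorption and distributivity, b = b \<sqinter> (b \<squnion> c) = b \<sqinter> (a
  \<squnion> c) = (b \<sqinter> a) \<squnion> (b \<sqinter> c) = a \<squnion> (a \<sqinter> c) =
  a.\<close>

lemma (in Lattice.lattice) not_distributive_if_pentagon:
  assumes carr: "a \<in> carrier L" "b \<in> carrier L" "c \<in> carrier L"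
    and "a \<sqsubseteq> b" "a \<noteq> b"
    and meets: "a \<sqinter> c = b \<sqinter> c" and joins: "a \<squnion> c = b \<squnion> c"
  shows "\<not> distributive L"
proof
  assume "distributive L"
  then have "b \<sqinter> (a \<squnion> c) = (b \<sqinter> a) \<squnion> (b \<sqinter> c)"
    using carr by (simp add: distributive_def)
  moreover have "b \<sqinter> (a \<squnion> c) = b"
    using carr by (metis joins join_closed join_left le_iff_join)
  moreover have "b \<sqinter> a = a"
    using carr \<open>a \<sqsubseteq> b\<close> by (metis le_iff_join meet_comm)
  moreover have "a \<squnion> (b \<sqinter> c) = a"
    using carr by (metis meets meet_closed meet_left le_iff_meet join_comm)
  ultimately show False
    using \<open>a \<noteq> b\<close> by simp
qed

locale two_chains_order =
  fixes L :: "'a gorder" (structure) and z a\<^sub>0 a\<^sub>1 b\<^sub>0 b\<^sub>1 u :: 'a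
  assumes carrier_eq: "carrier L = {z, a\<^sub>0, a\<^sub>1, b\<^sub>0, b\<^sub>1, u}"
    and distinct: "distinct [z, a\<^sub>0, a\<^sub>1, b\<^sub>0, b\<^sub>1, u]"
    and eq_eq: "(.=) = (=)"
    and le_iff: "x \<sqsubseteq> y \<longleftrightarrow> x = y \<or> x = z \<or> y = u \<or> (x = a\<^sub>0 \<and> y = b\<^sub>0) \<or> (x = a\<^sub>1 \<and> y = b\<^sub>1)"
begin

lemma distinct_simps:
  "z \<noteq> a\<^sub>0" "z \<noteq> a\<^sub>1" "z \<noteq> b\<^sub>0" "z \<noteq> b\<^sub>1" "z \<noteq> u" "a\<^sub>0 \<noteq> a\<^sub>1" "a\<^sub>0 \<noteq> b\<^sub>0" "a\<^sub>0 \<noteq> b\<^sub>1" "a\<^sub>0 \<noteq> u"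
  "a\<^sub>1 \<noteq> b\<^sub>0" "a\<^sub>1 \<noteq> b\<^sub>1" "a\<^sub>1 \<noteq> u" "b\<^sub>0 \<noteq> b\<^sub>1" "b\<^sub>0 \<noteq> u" "b\<^sub>1 \<noteq> u"
  using distinct by auto

lemma le_refl: "x \<sqsubseteq> x"
  by (simp add: le_iff)

lemma le_antisym: "x \<sqsubseteq> y \<Longrightarrow> y \<sqsubseteq> x \<Longrightarrow> x = y"
  unfolding le_iff using distinct_simps by metis

lemma le_trans: "x \<sqsubseteq> y \<Longrightarrow> y \<sqsubseteq> w \<Longrightarrow> x \<sqsubseteq> w"
  unfolding le_iff using distinct_simps by metis

sublocale partial_order L
proof
  show "x \<sqsubseteq> y \<Longrightarrow> y \<sqsubseteq> x \<Longrightarrow> x .= y" for x y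
    using le_antisym by (simp add: eq_eq)
  show "x \<sqsubseteq> y \<Longrightarrow> y \<sqsubseteq> w \<Longrightarrow> x \<sqsubseteq> w" for x y w
    by (rule le_trans)
qed (simp_all add: eq_eq le_refl)

text \<open>The elements below any w other than u form a chain, so two incomparable elements cannot
  both lie there. The next lemma is the dual.\<close>

lemma upper_bound_incomparable:
  assumes "\<not> x \<sqsubseteq> y" "\<not> y \<sqsubseteq> x" "x \<sqsubseteq> w" "y \<sqsubseteq> w"
  shows "w = u"
  using assms distinct_simps unfolding le_iff by metis

lemma lower_bound_incomparable:
  assumes "\<not> x \<sqsubseteq> y" "\<not> y \<sqsubseteq> x" "w \<sqsubseteq> x" "w \<sqsubseteq> y"
  shows "w = z"
  using assms distinct_simps unfolding le_iff by metis

lemma least_Upper_incomparable: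
  assumes "x \<in> carrier L" "y \<in> carrier L" "\<not> x \<sqsubseteq> y" "\<not> y \<sqsubseteq> x"
  shows "least L u (Upper L {x, y})"
proof (rule least_UpperI)
  show "u \<sqsubseteq> w" if "w \<in> Upper L {x, y}" for w
    using that assms upper_bound_incomparable[of x y w] le_refl by (simp add: Upper_def)
qed (use assms in \<open>simp_all add: le_iff carrier_eq\<close>)

lemma greatest_Lower_incomparable:
  assumes "x \<in> carrier L" "y \<in> carrier L" "\<not> x \<sqsubseteq> y" "\<not> y \<sqsubseteq> x"
  shows "greatest L z (Lower L {x, y})"
proof (rule greatest_LowerI)
  show "w \<sqsubseteq> z" if "w \<in> Lower L {x, y}" for w
    using that assms lower_bound_incomparable[of x y w] le_refl by (simp add: Lower_def)
qed (use assms in \<open>simp_all add: le_iff carrier_eq\<close>)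

lemma least_Upper_comparable:
  assumes "x \<in> carrier L" "y \<in> carrier L" "x \<sqsubseteq> y"
  shows "least L y (Upper L {x, y})"
  by (rule least_UpperI) (use assms le_refl in \<open>auto simp: Upper_def\<close>)

lemma greatest_Lower_comparable:
  assumes "x \<in> carrier L" "y \<in> carrier L" "x \<sqsubseteq> y"
  shows "greatest L x (Lower L {x, y})"
  by (rule greatest_LowerI) (use assms le_refl in \<open>auto simp: Lower_def\<close>)

sublocale Lattice.lattice L
proof
  fix x y assume "x \<in> carrier L" "y \<in> carrier L"
  \<comment> \<open>Either x \<sqsubseteq> y, or y \<sqsubseteq> x, or the two are incomparable;
    \<open>insert_commute\<close> reduces the second case to the first.\<close>
  then show "\<exists>s. least L s (Upper L {x, y})" "\<exists>s. greatest L s (Lower L {x, y})"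
    using least_Upper_comparable[of x y] least_Upper_comparable[of y x]
      greatest_Lower_comparable[of x y] greatest_Lower_comparable[of y x]
      least_Upper_incomparable[of x y] greatest_Lower_incomparable[of x y]
    by (metis insert_commute)+
qed

lemma not_distributive: "\<not> distributive L"
proof (rule not_distributive_if_pentagon)
  show carr: "a\<^sub>0 \<in> carrier L" "b\<^sub>0 \<in> carrier L" "a\<^sub>1 \<in> carrier L"
    by (simp_all add: carrier_eq)
  show "a\<^sub>0 \<sqsubseteq> b\<^sub>0" "a\<^sub>0 \<noteq> b\<^sub>0"
    using distinct_simps by (simp_all add: le_iff)
  \<comment> \<open>Hence both meets below are z and both joins are u.\<close>
  have incomparable: "\<not> a\<^sub>0 \<sqsubseteq> a\<^sub>1" "\<not> a\<^sub>1 \<sqsubseteq> a\<^sub>0" "\<not> b\<^sub>0 \<sqsubseteq> a\<^sub>1" "\<not> a\<^sub>1 \<sqsubseteq> b\<^sub>0"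
    unfolding le_iff using distinct_simps by metis+
  show "a\<^sub>0 \<sqinter> a\<^sub>1 = b\<^sub>0 \<sqinter> a\<^sub>1"
    using carr incomparable by (simp add: meet_eqI[OF _ _ greatest_Lower_incomparable])
  show "a\<^sub>0 \<squnion> a\<^sub>1 = b\<^sub>0 \<squnion> a\<^sub>1"
    using carr incomparable by (simp add: join_eqI[OF _ _ least_Upper_incomparable])
qed

end

lemma Lm_distinct:
  assumes "lam 0 \<noteq> 0" and "lam 1 \<noteq> 0"
    and "(cmod (lam 0))\<^sup>2 + (cmod (lam 1))\<^sup>2 = 1"
  shows "distinct [0, scaled_proj_op lam 0, scaled_proj_op lam 1, proj_op 0, proj_op 1, mat 1]"
proof -
  \<comment> \<open>If one coefficient were 1, normalisation would make the other vanish. This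
    separates O_i from P_i; the remaining pairs differ in which diagonal entries are
    nonzero.\<close>
  have lam: "lam 0 \<noteq> 1" "lam 1 \<noteq> 1"
    using assms by auto
  have entries: "A = B \<longleftrightarrow> (\<forall>i j. A $ i $ j = B $ i $ j)" for A B :: operator
    by (simp add: vec_eq_iff)
  have two: "(\<forall>i::2. Q i) \<longleftrightarrow> Q 0 \<and> Q 1" for Q
  proof -
    have "i = 0 \<or> i = 1" for i :: 2
      using exhaust_2[of i] by auto
    then show ?thesis by metis
  qed
  show ?thesis
    using assms(1,2) lam
    by (simp add: entries two proj_op_nth scaled_proj_op_nth mat_def)
qed

theorem mainTheorem5:
  fixes lam :: "2 \<Rightarrow> complex"
  assumes "lam 0 \<noteq> 0" and "lam 1 \<noteq> 0"
    and "(cmod (lam 0))\<^sup>2 + (cmod (lam 1))\<^sup>2 = 1"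
  shows "card (carrier (Lm lam)) = 6 \<and> lattice (Lm lam) \<and> \<not> distributive (Lm lam)"
proof -
  interpret two_chains_order "Lm lam" 0 "scaled_proj_op lam 0" "scaled_proj_op lam 1"
    "proj_op 0" "proj_op 1" "mat 1"
    \<comment> \<open>Deleting \<open>distinct.simps\<close> keeps the distinctness goal in the form
      that \<open>Lm_distinct\<close> rewrites.\<close>
    by unfold_locales (simp_all add: Lm_def op_le_iff[OF assms] Lm_distinct[OF assms] del: distinct.simps)
  have "card (carrier (Lm lam)) = 6"
    using distinct_card[OF Lm_distinct[OF assms]] by (simp add: carrier_eq)
  then show ?thesis
    using lattice_axioms not_distributive by blast
qed

end
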